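(* Let $w \in F_k'$ be a commutator word and let $G$ be a metabelian group. Suppose that $w\{G\} \subseteq Z(G)$. Then the word map $w \colon G^k \to Z(G)$ is polynomial.
   Context: A group word in $k$ variables is an element $w$ of the free group $F_k$ of rank $k$; it is a commutator word if $w\in F_k'=[F_k,F_k]$. It defines the word map $w\colon G^k\to G$ by substitution, and $w\{G\}=\{w(g_1,\dots,g_k)\mid g_i\in G\}$. $Z(G)$ is the centre of $G$. $G$ is an abstract (discrete) group. Polynomial maps: for groups $H$ and $A$, a map $f\colon H\to A$ and $h\in H$, put $\Delta_h f(x)=f(x)^{-1}f(xh)$ for $x\in H$. The map $f$ is polynomial of degree at most $n$ if $\Delta_{h_{n+1}}\cdots\Delta_{h_1}f(x)=1$ for all $x,h_1,\dots,h_{n+1}\in H$; it is polynomial if this holds for some integer $n\ge 0$. Here this is applied with $H=G^k$ (direct product) and $A=Z(G)$. *)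

theory Defs
  imports "HOL-Algebra.Algebra"
begin

section \<open>Free groups of finite rank\<close>

text \<open>
  Elements of the free group $F_k$ are reduced words in the letters $x_0, \dots, x_{k-1}$ and their
  inverses: the pair \<open>(i, True)\<close> stands for $x_i$ and \<open>(i, False)\<close> for its inverse.
\<close>

type_synonym letter = "nat \<times> bool"

definition inv_letter :: "letter \<Rightarrow> letter" where
  "inv_letter a = (fst a, \<not> snd a)"

definition reduced_word :: "letter list \<Rightarrow> bool" where
  "reduced_word w \<longleftrightarrow> successively (\<lambda>a b. b \<noteq> inv_letter a) w"

fun push_letter :: "letter \<Rightarrow> letter list \<Rightarrow> letter list" where
  "push_letter a [] = [a]"
| "push_letter a (b # w) = (if b = inv_letter a then w else a # b # w)"

text \<open>The product is concatenation followed by free reduction, carried out letter by letter.\<close>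

definition free_group :: "nat \<Rightarrow> letter list monoid" where
  "free_group k =
     \<lparr>carrier = {w. reduced_word w \<and> fst ` set w \<subseteq> {..<k}},
      monoid.mult = foldr push_letter,
      one = []\<rparr>"

definition commutator_words :: "nat \<Rightarrow> letter list set" where
  "commutator_words k = derived (free_group k) (carrier (free_group k))"

section \<open>Word maps\<close>

definition letter_value :: "('a, 'b) monoid_scheme \<Rightarrow> (nat \<Rightarrow> 'a) \<Rightarrow> letter \<Rightarrow> 'a" where
  "letter_value G g a = (if snd a then g (fst a) else inv\<^bsub>G\<^esub> g (fst a))"

definition word_map :: "('a, 'b) monoid_scheme \<Rightarrow> letter list \<Rightarrow> (nat \<Rightarrow> 'a) \<Rightarrow> 'a" where
  "word_map G w g = foldr (\<lambda>a y. letter_value G g a \<otimes>\<^bsub>G\<^esub> y) w \<one>\<^bsub>G\<^esub>"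

definition power_group :: "('a, 'b) monoid_scheme \<Rightarrow> nat \<Rightarrow> (nat \<Rightarrow> 'a) monoid" where
  "power_group G k = product_group {..<k} (\<lambda>_. G)"

definition word_values :: "('a, 'b) monoid_scheme \<Rightarrow> nat \<Rightarrow> letter list \<Rightarrow> 'a set" where
  "word_values G k w = word_map G w ` carrier (power_group G k)"

section \<open>Centre and metabelian groups\<close>

definition centre :: "('a, 'b) monoid_scheme \<Rightarrow> 'a set" where
  "centre G = {z \<in> carrier G. \<forall>g \<in> carrier G. z \<otimes>\<^bsub>G\<^esub> g = g \<otimes>\<^bsub>G\<^esub> z}"

definition metabelian :: "('a, 'b) monoid_scheme \<Rightarrow> bool" where
  "metabelian G \<longleftrightarrow> comm_group (G\<lparr>carrier := derived G (carrier G)\<rparr>)"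

section \<open>Polynomial maps between groups\<close>

definition diff_op ::
    "('h, 'c) monoid_scheme \<Rightarrow> ('a, 'b) monoid_scheme \<Rightarrow> 'h \<Rightarrow> ('h \<Rightarrow> 'a) \<Rightarrow> 'h \<Rightarrow> 'a" where
  "diff_op H A h f = (\<lambda>x. inv\<^bsub>A\<^esub> f x \<otimes>\<^bsub>A\<^esub> f (x \<otimes>\<^bsub>H\<^esub> h))"

text \<open>
  For a list \<open>hs = [h\<^sub>1, \<dots>, h\<^sub>m]\<close>, \<open>fold (diff_op H A) hs f\<close> applies the difference operator of
  \<open>h\<^sub>1\<close> first and that of \<open>h\<^sub>m\<close> last.
\<close>

definition polynomial_of_degree_le ::
    "('h, 'c) monoid_scheme \<Rightarrow> ('a, 'b) monoid_scheme \<Rightarrow> nat \<Rightarrow> ('h \<Rightarrow> 'a) \<Rightarrow> bool" where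
  "polynomial_of_degree_le H A n f \<longleftrightarrow>
     f \<in> carrier H \<rightarrow> carrier A \<and>
     (\<forall>hs x. length hs = n + 1 \<and> set hs \<subseteq> carrier H \<and> x \<in> carrier H \<longrightarrow>
        fold (diff_op H A) hs f x = \<one>\<^bsub>A\<^esub>)"

definition polynomial_map ::
    "('h, 'c) monoid_scheme \<Rightarrow> ('a, 'b) monoid_scheme \<Rightarrow> ('h \<Rightarrow> 'a) \<Rightarrow> bool" where
  "polynomial_map H A f \<longleftrightarrow> (\<exists>n. polynomial_of_degree_le H A n f)"

section \<open>Basic facts about free groups and word maps\<close>

lemma inv_letter_inv_letter [simp]: "inv_letter (inv_letter a) = a"
  by (simp add: inv_letter_def)

lemma fst_inv_letter [simp]: "fst (inv_letter a) = fst a"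
  by (simp add: inv_letter_def)

lemma inv_letter_eq_iff [simp]: "inv_letter a = inv_letter b \<longleftrightarrow> a = b"
  by (metis inv_letter_inv_letter)

lemma reduced_word_Nil [simp]: "reduced_word []"
  by (simp add: reduced_word_def)

lemma reduced_word_ConsD: "reduced_word (a # w) \<Longrightarrow> reduced_word w"
  by (cases w) (auto simp: reduced_word_def)

lemma reduced_push_letter: "reduced_word w \<Longrightarrow> reduced_word (push_letter a w)"
  by (cases w) (auto simp: reduced_word_def dest: reduced_word_ConsD[unfolded reduced_word_def])

lemma reduced_foldr_push: "reduced_word v \<Longrightarrow> reduced_word (foldr push_letter u v)"
  by (induction u) (auto intro: reduced_push_letter)

lemma push_push_inv:
  "reduced_word w \<Longrightarrow> push_letter a (push_letter (inv_letter a) w) = w"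
  by (cases w rule: list.exhaust; cases "tl w") (auto simp: reduced_word_def)

lemma foldr_push_Nil: "reduced_word w \<Longrightarrow> foldr push_letter w [] = w"
proof (induction w)
  case (Cons a w)
  then have "foldr push_letter w [] = w" by (blast dest: reduced_word_ConsD)
  then show ?case using Cons.prems by (cases w) (auto simp: reduced_word_def)
qed simp

lemma foldr_push_push:
  assumes "reduced_word t" "reduced_word w"
  shows "foldr push_letter (push_letter a t) w = push_letter a (foldr push_letter t w)"
  using assms push_push_inv[OF reduced_foldr_push[OF assms(2)]] by (cases t) auto

lemma foldr_push_assoc:
  assumes "reduced_word v" "reduced_word w"
  shows "foldr push_letter (foldr push_letter u v) w
    = foldr push_letter u (foldr push_letter v w)"
  using assms by (induction u) (auto simp: foldr_push_push reduced_foldr_push)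

lemma foldr_push_inverse:
  assumes "reduced_word v"
  shows "foldr push_letter (rev (map inv_letter u)) (foldr push_letter u v) = v"
proof (induction u)
  case (Cons a u)
  then show ?case
    using push_push_inv[OF reduced_foldr_push[OF assms, of u], of "inv_letter a"] by simp
qed simp

lemma reduced_inverse: "reduced_word w \<Longrightarrow> reduced_word (rev (map inv_letter w))"
  unfolding reduced_word_def successively_rev successively_map
  by (erule successively_mono) (metis inv_letter_inv_letter)

lemma set_push_letter: "set (push_letter a w) \<subseteq> insert a (set w)"
  by (cases w) auto

lemma set_foldr_push: "set (foldr push_letter u v) \<subseteq> set u \<union> set v"
  using set_push_letter by (induction u) fastforce+

theorem group_free_group: "group (free_group k)"
proof (rule groupI)
  fix u v assume "u \<in> carrier (free_group k)" "v \<in> carrier (free_group k)"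
  then show "u \<otimes>\<^bsub>free_group k\<^esub> v \<in> carrier (free_group k)"
    using image_mono[OF set_foldr_push[of u v], of fst]
    by (simp add: free_group_def reduced_foldr_push image_Un) (meson Un_least order_trans)
next
  fix u assume u: "u \<in> carrier (free_group k)"
  have "rev (map inv_letter u) \<in> carrier (free_group k)"
    using u reduced_inverse[of u] by (auto simp: free_group_def)
  moreover have "rev (map inv_letter u) \<otimes>\<^bsub>free_group k\<^esub> u = \<one>\<^bsub>free_group k\<^esub>"
    using u foldr_push_inverse[of "[]" u] by (simp add: free_group_def foldr_push_Nil)
  ultimately show "\<exists>y \<in> carrier (free_group k). y \<otimes>\<^bsub>free_group k\<^esub> u = \<one>\<^bsub>free_group k\<^esub>"
    by blast
qed (auto simp: free_group_def foldr_push_assoc)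

lemma (in group) letter_value_closed:
  assumes "g \<in> {..<k} \<rightarrow> carrier G" "fst a < k"
  shows "letter_value G g a \<in> carrier G"
  using assms by (auto simp: letter_value_def Pi_iff)

lemma (in group) word_map_closed:
  assumes "g \<in> {..<k} \<rightarrow> carrier G" "fst ` set w \<subseteq> {..<k}"
  shows "word_map G w g \<in> carrier G"
  using assms(2) by (induction w) (auto simp: word_map_def letter_value_closed[OF assms(1)])

lemma (in group) word_map_push:
  assumes g: "g \<in> {..<k} \<rightarrow> carrier G" and a: "fst a < k" and w: "fst ` set w \<subseteq> {..<k}"
  shows "word_map G (push_letter a w) g = letter_value G g a \<otimes> word_map G w g"
proof (cases w)
  case (Cons b v)
  have v: "word_map G v g \<in> carrier G"
    using w Cons by (intro word_map_closed[OF g]) auto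
  have "g (fst a) \<in> carrier G" using g a by auto
  then have "letter_value G g a \<otimes> (letter_value G g (inv_letter a) \<otimes> word_map G v g)
      = word_map G v g"
    using v by (auto simp: letter_value_def inv_letter_def simp flip: m_assoc)
  then show ?thesis using Cons by (auto simp: word_map_def)
qed (simp add: word_map_def)

text \<open>
  Substituting a tuple into words is the homomorphism from the free group that sends the
  generators to the entries of the tuple.
\<close>

theorem (in group) word_map_hom:
  assumes g: "g \<in> {..<k} \<rightarrow> carrier G"
  shows "(\<lambda>w. word_map G w g) \<in> hom (free_group k) G"
proof (rule homI)
  fix u v assume u: "u \<in> carrier (free_group k)" and v: "v \<in> carrier (free_group k)"
  show "word_map G u g \<in> carrier G"
    using u word_map_closed[OF g] by (simp add: free_group_def)
  have v': "fst ` set v \<subseteq> {..<k}" using v by (simp add: free_group_def)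
  have "word_map G (foldr push_letter u v) g = word_map G u g \<otimes> word_map G v g"
    if "fst ` set u \<subseteq> {..<k}" for u
    using that
  proof (induction u)
    case Nil
    show ?case using word_map_closed[OF g v'] by (simp add: word_map_def)
  next
    case (Cons a u)
    have "fst ` set (foldr push_letter u v) \<subseteq> {..<k}"
      using image_mono[OF set_foldr_push[of u v], of fst] Cons.prems v'
      by (simp add: image_Un) (meson Un_least order_trans)
    then have "word_map G (foldr push_letter (a # u) v) g
        = letter_value G g a \<otimes> (word_map G u g \<otimes> word_map G v g)"
      using word_map_push[OF g] Cons by simp
    also have "\<dots> = word_map G (a # u) g \<otimes> word_map G v g"
      using Cons.prems letter_value_closed[OF g, of a] word_map_closed[OF g, of u]
        word_map_closed[OF g v'] by (simp add: word_map_def m_assoc)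
    finally show ?case .
  qed
  then show "word_map G (u \<otimes>\<^bsub>free_group k\<^esub> v) g = word_map G u g \<otimes> word_map G v g"
    using u by (simp add: free_group_def)
qed

lemma (in group) word_map_generator:
  assumes "g i \<in> carrier G"
  shows "word_map G [(i, True)] g = g i"
  using assms by (simp add: word_map_def letter_value_def)

end

theory Submission
  imports Defs
begin

text \<open>
  Let $G$ be metabelian, so that $D = G'$ is abelian, and write \<open>T\<^sub>h f (x) = f (x h)\<close> for
  maps $f$ from the group $H = G^k$ to $D$. Since $D$ acts trivially on itself by conjugation, the
  action of $G$ on $D$ factors through the abelian group $G/D$. Every word $u$ therefore gives a
  character: conjugating by \<open>u(x)\<close> is an automorphism of $D$ that depends multiplicatively on
  $x \<in> H$, although $u$ itself is not a homomorphism.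

  The values of a commutator word, written additively, are a sum of terms
  \<open>\<plusminus> \<chi>(x) [x\<^sub>i, x\<^sub>j]\<close> with characters \<open>\<chi>\<close>: an exponential polynomial
  in $x$. Accordingly it is annihilated by some product of twisted differences,
  \<open>(T\<^bsub>h\<^sub>N\<^esub> - \<chi>\<^sub>N(h\<^sub>N)) \<dots> (T\<^bsub>h\<^sub>1\<^esub> - \<chi>\<^sub>1(h\<^sub>1)) w = 0\<close>, for a fixed list
  of characters \<open>\<chi>\<^sub>1, \<dots>, \<chi>\<^sub>N\<close> and all \<open>h\<^sub>1, \<dots>, h\<^sub>N\<close>
  (\<open>commutator_word_exponential_polynomial\<close>).

  If the values of $w$ are central, conjugation fixes them, so \<open>\<chi>\<^sub>1(h\<^sub>1) w = w\<close> and the first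
  twisted difference is the ordinary difference of $w$. Its values are again central, so the same
  happens at every later stage. Thus all $N$-fold ordinary differences of $w$ vanish, and $w$ is
  polynomial (\<open>central_exponential_polynomial_is_polynomial\<close>).
\<close>

section \<open>Conjugation and commutators in a metabelian group\<close>

text \<open>
  The domain $H$ is an arbitrary group here; the direct power of $G$ enters only with word maps.
\<close>

locale metabelian_valued_maps = group G + H: group H for G (structure) and H (structure) +
  assumes metabelian: "metabelian G"
begin

abbreviation D where "D \<equiv> derived G (carrier G)"

definition act where "act g a = g \<otimes>\<^bsub>G\<^esub> a \<otimes>\<^bsub>G\<^esub> inv\<^bsub>G\<^esub> g"

definition comm where "comm x y = x \<otimes>\<^bsub>G\<^esub> y \<otimes>\<^bsub>G\<^esub> inv\<^bsub>G\<^esub> x \<otimes>\<^bsub>G\<^esub> inv\<^bsub>G\<^esub> y"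

lemma derived_subgroup: "subgroup D G"
  using derived_is_subgroup by blast

lemma D_carrier [simp]: "a \<in> D \<Longrightarrow> a \<in> carrier G"
  using derived_subgroup subgroup.mem_carrier by fast

lemma D_closed [simp]:
  "\<one>\<^bsub>G\<^esub> \<in> D" "a \<in> D \<Longrightarrow> b \<in> D \<Longrightarrow> a \<otimes>\<^bsub>G\<^esub> b \<in> D" "a \<in> D \<Longrightarrow> inv\<^bsub>G\<^esub> a \<in> D"
  using derived_subgroup by (auto simp: subgroup_def)

lemma comm_in_D [simp]: "x \<in> carrier G \<Longrightarrow> y \<in> carrier G \<Longrightarrow> comm x y \<in> D"
  unfolding derived_def comm_def by (rule generate.incl) auto

lemma D_commute: "a \<in> D \<Longrightarrow> b \<in> D \<Longrightarrow> a \<otimes>\<^bsub>G\<^esub> b = b \<otimes>\<^bsub>G\<^esub> a"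
  using metabelian comm_groupE(4) unfolding metabelian_def by fastforce

lemma D_left_commute:
  "a \<in> D \<Longrightarrow> b \<in> D \<Longrightarrow> c \<in> D \<Longrightarrow> a \<otimes>\<^bsub>G\<^esub> (b \<otimes>\<^bsub>G\<^esub> c) = b \<otimes>\<^bsub>G\<^esub> (a \<otimes>\<^bsub>G\<^esub> c)"
  by (metis D_carrier D_commute m_assoc)

lemma D_inv_mult:
  "a \<in> D \<Longrightarrow> b \<in> D \<Longrightarrow> inv\<^bsub>G\<^esub> (a \<otimes>\<^bsub>G\<^esub> b) = inv\<^bsub>G\<^esub> a \<otimes>\<^bsub>G\<^esub> inv\<^bsub>G\<^esub> b"
  by (metis D_carrier D_closed(3) D_commute inv_mult_group)

lemmas D_ac = D_commute D_left_commute D_inv_mult m_assoc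

lemma cancel_left [simp]:
  "a \<in> carrier G \<Longrightarrow> b \<in> carrier G \<Longrightarrow> inv\<^bsub>G\<^esub> a \<otimes>\<^bsub>G\<^esub> (a \<otimes>\<^bsub>G\<^esub> b) = b"
  "a \<in> carrier G \<Longrightarrow> b \<in> carrier G \<Longrightarrow> a \<otimes>\<^bsub>G\<^esub> (inv\<^bsub>G\<^esub> a \<otimes>\<^bsub>G\<^esub> b) = b"
  by (simp_all flip: m_assoc)

lemma act_one [simp]: "a \<in> D \<Longrightarrow> act \<one>\<^bsub>G\<^esub> a = a"
  by (simp add: act_def)

lemma act_closed [simp]:
  assumes "g \<in> carrier G" "a \<in> D" shows "act g a \<in> D"
proof -
  have "act g a = comm g a \<otimes>\<^bsub>G\<^esub> a"
    using assms by (simp add: act_def comm_def m_assoc)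
  then show ?thesis using assms by simp
qed

lemma act_mult:
  "g \<in> carrier G \<Longrightarrow> h \<in> carrier G \<Longrightarrow> a \<in> D \<Longrightarrow> act (g \<otimes>\<^bsub>G\<^esub> h) a = act g (act h a)"
  by (simp add: act_def m_assoc inv_mult_group)

lemma act_add:
  "g \<in> carrier G \<Longrightarrow> a \<in> D \<Longrightarrow> b \<in> D \<Longrightarrow> act g (a \<otimes>\<^bsub>G\<^esub> b) = act g a \<otimes>\<^bsub>G\<^esub> act g b"
  by (simp add: act_def m_assoc)

lemma act_inv:
  "g \<in> carrier G \<Longrightarrow> a \<in> D \<Longrightarrow> act g (inv\<^bsub>G\<^esub> a) = inv\<^bsub>G\<^esub> (act g a)"
  by (simp add: act_def m_assoc inv_mult_group)

lemma act_unit [simp]: "g \<in> carrier G \<Longrightarrow> act g \<one>\<^bsub>G\<^esub> = \<one>\<^bsub>G\<^esub>"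
  by (simp add: act_def)

text \<open>
  The two orders of acting differ by the commutator of $g$ and $h$, which lies in the abelian group
  $D$ and so acts trivially.
\<close>

lemma act_commute:
  assumes "g \<in> carrier G" "h \<in> carrier G" "a \<in> D"
  shows "act g (act h a) = act h (act g a)"
proof -
  have "act (comm g h) b = b" if "b \<in> D" for b
    using that assms D_commute[of "comm g h" b] by (simp add: act_def m_assoc)
  then have "act (comm g h) (act h (act g a)) = act h (act g a)"
    using assms by simp
  moreover have "comm g h \<otimes>\<^bsub>G\<^esub> (h \<otimes>\<^bsub>G\<^esub> g) = g \<otimes>\<^bsub>G\<^esub> h"
    using assms by (simp add: comm_def m_assoc)
  ultimately show ?thesis using assms by (metis act_mult act_closed m_closed comm_in_D D_carrier)
qed

lemma act_inv_cancel [simp]: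
  assumes "g \<in> carrier G" "a \<in> D"
  shows "act g (act (inv\<^bsub>G\<^esub> g) a) = a" "act (inv\<^bsub>G\<^esub> g) (act g a) = a"
  using assms by (simp_all flip: act_mult)

lemma comm_mult_left:
  assumes "x \<in> carrier G" "y \<in> carrier G" "z \<in> carrier G"
  shows "comm (x \<otimes>\<^bsub>G\<^esub> y) z = act x (comm y z) \<otimes>\<^bsub>G\<^esub> comm x z"
  using assms by (simp add: comm_def act_def m_assoc inv_mult_group)

lemma comm_mult_right:
  assumes "x \<in> carrier G" "y \<in> carrier G" "z \<in> carrier G"
  shows "comm x (y \<otimes>\<^bsub>G\<^esub> z) = comm x y \<otimes>\<^bsub>G\<^esub> act y (comm x z)"
  using assms by (simp add: comm_def act_def m_assoc inv_mult_group)

lemma comm_inv_left: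
  assumes "x \<in> carrier G" "z \<in> carrier G"
  shows "comm (inv\<^bsub>G\<^esub> x) z = act (inv\<^bsub>G\<^esub> x) (inv\<^bsub>G\<^esub> (comm x z))"
  using assms by (simp add: comm_def act_def m_assoc inv_mult_group)

lemma comm_swap:
  assumes "x \<in> carrier G" "z \<in> carrier G"
  shows "comm z x = inv\<^bsub>G\<^esub> (comm x z)"
  using assms by (simp add: comm_def m_assoc inv_mult_group)

section \<open>Characters\<close>

text \<open>
  A character is represented by elements of $G$ and not by the automorphisms of $D$ they induce, so
  multiplicativity is only required up to elements acting trivially on $D$.
\<close>

definition characters where
  "characters = {\<chi> \<in> carrier H \<rightarrow> carrier G.
     \<forall>x\<in>carrier H. \<forall>y\<in>carrier H. \<forall>a\<in>D. act (\<chi> (x \<otimes>\<^bsub>H\<^esub> y)) a = act (\<chi> x) (act (\<chi> y) a)}"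

lemma character_closed [simp]: "\<chi> \<in> characters \<Longrightarrow> x \<in> carrier H \<Longrightarrow> \<chi> x \<in> carrier G"
  unfolding characters_def by blast

lemma character_mult:
  "\<chi> \<in> characters \<Longrightarrow> x \<in> carrier H \<Longrightarrow> y \<in> carrier H \<Longrightarrow> a \<in> D \<Longrightarrow>
    act (\<chi> (x \<otimes>\<^bsub>H\<^esub> y)) a = act (\<chi> x) (act (\<chi> y) a)"
  unfolding characters_def by blast

lemma hom_character: "p \<in> hom H G \<Longrightarrow> p \<in> characters"
  unfolding characters_def using hom_mult[of p H G] hom_in_carrier[of p H G]
  by (auto intro!: act_mult)

lemma trivial_character: "(\<lambda>_. \<one>\<^bsub>G\<^esub>) \<in> characters"
  unfolding characters_def by simp

text \<open>Commutativity of the action moves $\<chi>(y)$ past $\<psi>(x)$.\<close>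

lemma mult_character:
  assumes \<chi>: "\<chi> \<in> characters" and \<psi>: "\<psi> \<in> characters"
  shows "(\<lambda>x. \<chi> x \<otimes>\<^bsub>G\<^esub> \<psi> x) \<in> characters"
proof -
  have "act (\<chi> (x \<otimes>\<^bsub>H\<^esub> y) \<otimes>\<^bsub>G\<^esub> \<psi> (x \<otimes>\<^bsub>H\<^esub> y)) a
      = act (\<chi> x \<otimes>\<^bsub>G\<^esub> \<psi> x) (act (\<chi> y \<otimes>\<^bsub>G\<^esub> \<psi> y) a)"
    if x: "x \<in> carrier H" and y: "y \<in> carrier H" and a: "a \<in> D" for x y a
  proof -
    have "act (\<chi> (x \<otimes>\<^bsub>H\<^esub> y) \<otimes>\<^bsub>G\<^esub> \<psi> (x \<otimes>\<^bsub>H\<^esub> y)) a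
        = act (\<chi> x) (act (\<chi> y) (act (\<psi> x) (act (\<psi> y) a)))"
      using \<chi> \<psi> x y a by (simp add: act_mult character_mult)
    also have "act (\<chi> y) (act (\<psi> x) (act (\<psi> y) a)) = act (\<psi> x) (act (\<chi> y) (act (\<psi> y) a))"
      using \<chi> \<psi> x y a by (intro act_commute) auto
    finally show ?thesis using \<chi> \<psi> x y a by (simp add: act_mult)
  qed
  then show ?thesis unfolding characters_def using \<chi> \<psi> by (simp add: Pi_iff)
qed

lemma inv_character:
  assumes "\<chi> \<in> characters"
  shows "(\<lambda>x. inv\<^bsub>G\<^esub> \<chi> x) \<in> characters"
proof -
  have "act (inv\<^bsub>G\<^esub> \<chi> (x \<otimes>\<^bsub>H\<^esub> y)) a = act (inv\<^bsub>G\<^esub> \<chi> x) (act (inv\<^bsub>G\<^esub> \<chi> y) a)"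
    if x: "x \<in> carrier H" and y: "y \<in> carrier H" and a: "a \<in> D" for x y a
  proof -
    define b where "b = act (inv\<^bsub>G\<^esub> \<chi> x) (act (inv\<^bsub>G\<^esub> \<chi> y) a)"
    have b: "b \<in> D" using assms x y a by (simp add: b_def)
    have "act (\<chi> (x \<otimes>\<^bsub>H\<^esub> y)) b = a"
      using assms x y a b character_mult[OF assms x y b] unfolding b_def
      by (simp add: act_commute[of "\<chi> x" "\<chi> y"])
    then show ?thesis using assms x y b unfolding b_def[symmetric]
      by (metis H.m_closed act_inv_cancel(2) character_closed)
  qed
  then show ?thesis unfolding characters_def using assms by (simp add: Pi_iff)
qed

section \<open>Maps annihilated by products of twisted differences\<close>

text \<open>
  In additive notation, \<open>annihilated [\<chi>\<^sub>1, \<dots>, \<chi>\<^sub>N] f\<close> says that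
  \<open>(T\<^bsub>h\<^sub>N\<^esub> - \<chi>\<^sub>N(h\<^sub>N)) \<dots> (T\<^bsub>h\<^sub>1\<^esub> - \<chi>\<^sub>1(h\<^sub>1)) f = 0\<close> on $H$ for all
  \<open>h\<^sub>1, \<dots>, h\<^sub>N\<close>. The list of characters is independent of the \<open>h\<^sub>i\<close>, so that the
  maps annihilated by a given list are closed under products.
\<close>

fun annihilated where
  "annihilated [] f \<longleftrightarrow> (\<forall>x\<in>carrier H. f x = \<one>\<^bsub>G\<^esub>)"
| "annihilated (\<chi> # L) f \<longleftrightarrow>
     (\<forall>h\<in>carrier H. annihilated L (\<lambda>x. f (x \<otimes>\<^bsub>H\<^esub> h) \<otimes>\<^bsub>G\<^esub> inv\<^bsub>G\<^esub> act (\<chi> h) (f x)))"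

lemma annihilated_cong:
  "annihilated L f \<Longrightarrow> (\<And>x. x \<in> carrier H \<Longrightarrow> f x = g x) \<Longrightarrow> annihilated L g"
proof (induction L arbitrary: f g)
  case (Cons \<chi> L)
  show ?case unfolding annihilated.simps
  proof
    fix h assume "h \<in> carrier H"
    then show "annihilated L (\<lambda>x. g (x \<otimes>\<^bsub>H\<^esub> h) \<otimes>\<^bsub>G\<^esub> inv\<^bsub>G\<^esub> act (\<chi> h) (g x))"
      using Cons.prems by (intro Cons.IH[OF Cons.prems(1)[simplified, rule_format]]) auto
  qed
qed auto

lemma annihilated_one:
  "set L \<subseteq> characters \<Longrightarrow> (\<And>x. x \<in> carrier H \<Longrightarrow> f x = \<one>\<^bsub>G\<^esub>) \<Longrightarrow> annihilated L f"
  by (induction L arbitrary: f) auto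

lemma annihilated_mult:
  assumes "set L \<subseteq> characters" "f \<in> carrier H \<rightarrow> D" "g \<in> carrier H \<rightarrow> D"
    "annihilated L f" "annihilated L g"
  shows "annihilated L (\<lambda>x. f x \<otimes>\<^bsub>G\<^esub> g x)"
  using assms
proof (induction L arbitrary: f g)
  case (Cons \<chi> L)
  show ?case unfolding annihilated.simps
  proof
    fix h assume h: "h \<in> carrier H"
    have "annihilated L (\<lambda>x. (f (x \<otimes>\<^bsub>H\<^esub> h) \<otimes>\<^bsub>G\<^esub> inv\<^bsub>G\<^esub> act (\<chi> h) (f x)) \<otimes>\<^bsub>G\<^esub>
        (g (x \<otimes>\<^bsub>H\<^esub> h) \<otimes>\<^bsub>G\<^esub> inv\<^bsub>G\<^esub> act (\<chi> h) (g x)))"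
      by (rule Cons.IH) (use Cons.prems h in \<open>auto simp: Pi_iff\<close>)
    then show "annihilated L (\<lambda>x. (f (x \<otimes>\<^bsub>H\<^esub> h) \<otimes>\<^bsub>G\<^esub> g (x \<otimes>\<^bsub>H\<^esub> h)) \<otimes>\<^bsub>G\<^esub>
        inv\<^bsub>G\<^esub> act (\<chi> h) (f x \<otimes>\<^bsub>G\<^esub> g x))"
      by (rule annihilated_cong)
        (use Cons.prems h in \<open>simp add: Pi_iff act_add D_ac\<close>)
  qed
qed auto

lemma annihilated_inv:
  assumes "set L \<subseteq> characters" "f \<in> carrier H \<rightarrow> D" "annihilated L f"
  shows "annihilated L (\<lambda>x. inv\<^bsub>G\<^esub> f x)"
  using assms
proof (induction L arbitrary: f)
  case (Cons \<chi> L)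
  show ?case unfolding annihilated.simps
  proof
    fix h assume h: "h \<in> carrier H"
    have "annihilated L (\<lambda>x. inv\<^bsub>G\<^esub> (f (x \<otimes>\<^bsub>H\<^esub> h) \<otimes>\<^bsub>G\<^esub> inv\<^bsub>G\<^esub> act (\<chi> h) (f x)))"
      using Cons.prems h by (intro Cons.IH) (auto simp: Pi_iff)
    then show "annihilated L (\<lambda>x. inv\<^bsub>G\<^esub> f (x \<otimes>\<^bsub>H\<^esub> h) \<otimes>\<^bsub>G\<^esub> inv\<^bsub>G\<^esub> act (\<chi> h) (inv\<^bsub>G\<^esub> f x))"
      by (rule annihilated_cong)
        (use Cons.prems h in \<open>simp add: Pi_iff act_inv D_inv_mult\<close>)
  qed
qed auto

lemma annihilated_act:
  assumes "set L \<subseteq> characters" "f \<in> carrier H \<rightarrow> D" "annihilated L f" "c \<in> carrier G"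
  shows "annihilated L (\<lambda>x. act c (f x))"
  using assms
proof (induction L arbitrary: f)
  case (Cons \<chi> L)
  show ?case unfolding annihilated.simps
  proof
    fix h assume h: "h \<in> carrier H"
    have "annihilated L (\<lambda>x. act c (f (x \<otimes>\<^bsub>H\<^esub> h) \<otimes>\<^bsub>G\<^esub> inv\<^bsub>G\<^esub> act (\<chi> h) (f x)))"
      using Cons.prems h by (intro Cons.IH) (auto simp: Pi_iff)
    then show "annihilated L (\<lambda>x. act c (f (x \<otimes>\<^bsub>H\<^esub> h)) \<otimes>\<^bsub>G\<^esub> inv\<^bsub>G\<^esub> act (\<chi> h) (act c (f x)))"
      by (rule annihilated_cong)
        (use Cons.prems h in \<open>simp add: Pi_iff act_add act_inv act_commute[of c]\<close>)
  qed
qed auto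

text \<open>
  Translations of the possibly nonabelian group $H$ do not commute, but
  \<open>T\<^sub>h T\<^sub>k = T\<^sub>k T\<^bsub>h'\<^esub>\<close> with the conjugate $h' = k^{-1} h k$, and every character takes
  equal values, as automorphisms of $D$, at $h$ and at $h'$.
\<close>

lemma annihilated_translate:
  assumes "set L \<subseteq> characters" "f \<in> carrier H \<rightarrow> D" "annihilated L f" "k \<in> carrier H"
  shows "annihilated L (\<lambda>x. f (x \<otimes>\<^bsub>H\<^esub> k))"
  using assms
proof (induction L arbitrary: f)
  case (Cons \<chi> L)
  show ?case unfolding annihilated.simps
  proof
    fix h assume h: "h \<in> carrier H"
    define h' where "h' = inv\<^bsub>H\<^esub> k \<otimes>\<^bsub>H\<^esub> (h \<otimes>\<^bsub>H\<^esub> k)"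
    have h': "h' \<in> carrier H" and kh': "k \<otimes>\<^bsub>H\<^esub> h' = h \<otimes>\<^bsub>H\<^esub> k"
      using h Cons.prems by (simp_all add: h'_def flip: H.m_assoc)
    have k: "k \<in> carrier H" and \<chi>: "\<chi> \<in> characters" and f: "f \<in> carrier H \<rightarrow> D"
      using Cons.prems by auto
    have act_eq: "act (\<chi> h') a = act (\<chi> h) a" if a: "a \<in> D" for a
    proof -
      have "act (\<chi> k) (act (\<chi> h') a) = act (\<chi> k) (act (\<chi> h) a)"
        using character_mult[OF \<chi> k h' a] character_mult[OF \<chi> h k a] act_commute[of "\<chi> k" "\<chi> h" a]
          kh' k \<chi> h a by simp
      then show ?thesis using act_inv_cancel(2) k \<chi> h h' a by (metis act_closed character_closed)
    qed
    have "annihilated L (\<lambda>x. f (x \<otimes>\<^bsub>H\<^esub> k \<otimes>\<^bsub>H\<^esub> h') \<otimes>\<^bsub>G\<^esub> inv\<^bsub>G\<^esub> act (\<chi> h') (f (x \<otimes>\<^bsub>H\<^esub> k)))"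
      using Cons.prems h'
      by (intro Cons.IH[of "\<lambda>x. f (x \<otimes>\<^bsub>H\<^esub> h') \<otimes>\<^bsub>G\<^esub> inv\<^bsub>G\<^esub> act (\<chi> h') (f x)"]) (auto simp: Pi_iff)
    then show "annihilated L
        (\<lambda>x. f (x \<otimes>\<^bsub>H\<^esub> h \<otimes>\<^bsub>H\<^esub> k) \<otimes>\<^bsub>G\<^esub> inv\<^bsub>G\<^esub> act (\<chi> h) (f (x \<otimes>\<^bsub>H\<^esub> k)))"
      by (rule annihilated_cong)
        (use f k h h' kh' act_eq in \<open>simp add: Pi_iff H.m_assoc\<close>)
  qed
qed auto

text \<open>
  A twisted difference of $f$ is built from a translate and a conjugate of $f$, both of which are
  annihilated by the list that annihilates $f$.
\<close>

lemma annihilated_Cons: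
  assumes "set L \<subseteq> characters" "f \<in> carrier H \<rightarrow> D" "annihilated L f" "\<chi> \<in> characters"
  shows "annihilated (\<chi> # L) f"
  unfolding annihilated.simps
proof
  fix h assume h: "h \<in> carrier H"
  have "annihilated L (\<lambda>x. act (\<chi> h) (f x))"
    using assms h by (intro annihilated_act) auto
  then have "annihilated L (\<lambda>x. inv\<^bsub>G\<^esub> act (\<chi> h) (f x))"
    by (rule annihilated_inv[rotated -1]) (use assms h in \<open>auto simp: Pi_iff\<close>)
  then show "annihilated L (\<lambda>x. f (x \<otimes>\<^bsub>H\<^esub> h) \<otimes>\<^bsub>G\<^esub> inv\<^bsub>G\<^esub> act (\<chi> h) (f x))"
    by (rule annihilated_mult[rotated -1])
      (use assms h annihilated_translate[of L f h] in \<open>auto simp: Pi_iff\<close>)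
qed

lemma annihilated_append_left:
  assumes "set L \<subseteq> characters" "set M \<subseteq> characters" "f \<in> carrier H \<rightarrow> D" "annihilated L f"
  shows "annihilated (M @ L) f"
  using assms(2)
proof (induction M)
  case (Cons \<chi> M)
  then show ?case
    using annihilated_Cons[of "M @ L" f \<chi>] assms by (simp del: annihilated.simps)
qed (simp add: assms)

lemma annihilated_append_right:
  assumes "set M \<subseteq> characters" "annihilated L f"
  shows "annihilated (L @ M) f"
  using assms(2) by (induction L arbitrary: f) (auto intro: annihilated_one[OF assms(1)])

lemma annihilated_mult_append:
  assumes "set L \<subseteq> characters" "set M \<subseteq> characters"
    "f \<in> carrier H \<rightarrow> D" "g \<in> carrier H \<rightarrow> D" "annihilated L f" "annihilated M g"
  shows "annihilated (L @ M) (\<lambda>x. f x \<otimes>\<^bsub>G\<^esub> g x)"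
  using assms
  by (simp add: annihilated_mult annihilated_append_left annihilated_append_right)

text \<open>
  Multiplying by a character $\<psi>$ intertwines the twisted differences:
  \<open>(T\<^sub>h - \<psi>(h) \<chi>(h)) (\<psi> f) = \<psi> \<psi>(h) (T\<^sub>h - \<chi>(h)) f\<close>.
\<close>

lemma annihilated_twist:
  assumes "set L \<subseteq> characters" "f \<in> carrier H \<rightarrow> D" "annihilated L f" "\<psi> \<in> characters"
  shows "annihilated (map (\<lambda>\<chi> x. \<psi> x \<otimes>\<^bsub>G\<^esub> \<chi> x) L) (\<lambda>x. act (\<psi> x) (f x))"
  using assms
proof (induction L arbitrary: f)
  case (Cons \<chi> L)
  have \<chi>: "\<chi> \<in> characters" and f: "f \<in> carrier H \<rightarrow> D" using Cons.prems by auto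
  show ?case unfolding annihilated.simps list.map
  proof
    fix h assume h: "h \<in> carrier H"
    let ?d = "\<lambda>x. f (x \<otimes>\<^bsub>H\<^esub> h) \<otimes>\<^bsub>G\<^esub> inv\<^bsub>G\<^esub> act (\<chi> h) (f x)"
    have d: "?d \<in> carrier H \<rightarrow> D" using \<chi> f h by (auto simp: Pi_iff)
    have "annihilated L (\<lambda>x. act (\<psi> h) (?d x))"
      using Cons.prems h d by (intro annihilated_act) auto
    then have "annihilated (map (\<lambda>\<chi> x. \<psi> x \<otimes>\<^bsub>G\<^esub> \<chi> x) L) (\<lambda>x. act (\<psi> x) (act (\<psi> h) (?d x)))"
      using Cons.prems h \<chi> by (intro Cons.IH) (auto simp: Pi_iff)
    then show "annihilated (map (\<lambda>\<chi> x. \<psi> x \<otimes>\<^bsub>G\<^esub> \<chi> x) L) (\<lambda>x. act (\<psi> (x \<otimes>\<^bsub>H\<^esub> h)) (f (x \<otimes>\<^bsub>H\<^esub> h))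
        \<otimes>\<^bsub>G\<^esub> inv\<^bsub>G\<^esub> act (\<psi> h \<otimes>\<^bsub>G\<^esub> \<chi> h) (act (\<psi> x) (f x)))"
    proof (rule annihilated_cong)
      fix x assume x: "x \<in> carrier H"
      have \<psi>: "\<psi> \<in> characters" and fx: "f x \<in> D" and fxh: "f (x \<otimes>\<^bsub>H\<^esub> h) \<in> D"
        using Cons.prems x h by auto
      have "act (\<psi> h) (act (\<chi> h) (act (\<psi> x) (f x))) = act (\<psi> x) (act (\<psi> h) (act (\<chi> h) (f x)))"
        using \<chi> \<psi> fx x h act_commute[of "\<chi> h" "\<psi> x" "f x"]
          act_commute[of "\<psi> h" "\<psi> x" "act (\<chi> h) (f x)"] by simp
      then show "act (\<psi> x) (act (\<psi> h) (?d x)) = act (\<psi> (x \<otimes>\<^bsub>H\<^esub> h)) (f (x \<otimes>\<^bsub>H\<^esub> h))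
        \<otimes>\<^bsub>G\<^esub> inv\<^bsub>G\<^esub> act (\<psi> h \<otimes>\<^bsub>G\<^esub> \<chi> h) (act (\<psi> x) (f x))"
        using \<chi> \<psi> fx fxh x h by (simp add: character_mult act_mult act_add act_inv)
    qed
  qed
qed auto

lemma annihilated_const: "c \<in> D \<Longrightarrow> annihilated [\<lambda>_. \<one>\<^bsub>G\<^esub>] (\<lambda>_. c)"
  by simp

text \<open>
  By \<open>[c, q(x h)] = [c, q(x)] \<cdot> q(x)[c, q(h)]q(x)\<^sup>-\<^sup>1\<close>, the plain difference is the
  character $q$ applied to a constant. The product with the unit in the second list entry is the
  form in which \<open>annihilated_twist\<close> delivers it.
\<close>

lemma annihilated_comm_const:
  assumes "c \<in> carrier G" "q \<in> hom H G"
  shows "annihilated [\<lambda>_. \<one>\<^bsub>G\<^esub>, \<lambda>x. q x \<otimes>\<^bsub>G\<^esub> \<one>\<^bsub>G\<^esub>] (\<lambda>x. comm c (q x))"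
  unfolding annihilated.simps(2)[of "\<lambda>_. \<one>\<^bsub>G\<^esub>"]
proof
  fix h assume h: "h \<in> carrier H"
  have q: "q \<in> characters" using assms hom_character by simp
  have "annihilated [\<lambda>x. q x \<otimes>\<^bsub>G\<^esub> \<one>\<^bsub>G\<^esub>] (\<lambda>x. act (q x) (comm c (q h)))"
    using annihilated_twist[OF _ _ annihilated_const[of "comm c (q h)"] q] assms h q
      trivial_character by (simp del: annihilated.simps)
  then show "annihilated [\<lambda>x. q x \<otimes>\<^bsub>G\<^esub> \<one>\<^bsub>G\<^esub>]
      (\<lambda>x. comm c (q (x \<otimes>\<^bsub>H\<^esub> h)) \<otimes>\<^bsub>G\<^esub> inv\<^bsub>G\<^esub> act \<one>\<^bsub>G\<^esub> (comm c (q x)))"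
    by (rule annihilated_cong)
      (use assms h q in \<open>simp add: hom_mult comm_mult_right D_ac\<close>)
qed

section \<open>Exponential polynomials\<close>

definition exponential_polynomial where
  "exponential_polynomial f \<longleftrightarrow>
     f \<in> carrier H \<rightarrow> D \<and> (\<exists>L. set L \<subseteq> characters \<and> annihilated L f)"

lemma exponential_polynomial_cong:
  "exponential_polynomial f \<Longrightarrow> (\<And>x. x \<in> carrier H \<Longrightarrow> f x = g x) \<Longrightarrow> exponential_polynomial g"
  unfolding exponential_polynomial_def Pi_iff using annihilated_cong by metis

lemma exponential_polynomial_one: "exponential_polynomial (\<lambda>_. \<one>\<^bsub>G\<^esub>)"
  unfolding exponential_polynomial_def by (auto intro!: exI[of _ "[]"])

lemma exponential_polynomial_mult:
  assumes "exponential_polynomial f" "exponential_polynomial g"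
  shows "exponential_polynomial (\<lambda>x. f x \<otimes>\<^bsub>G\<^esub> g x)"
proof -
  obtain L M where "set L \<subseteq> characters" "annihilated L f" "set M \<subseteq> characters" "annihilated M g"
    using assms unfolding exponential_polynomial_def by blast
  then show ?thesis
    using annihilated_mult_append[of L M f g] assms unfolding exponential_polynomial_def
    by (auto simp: Pi_iff intro!: exI[of _ "L @ M"])
qed

lemma exponential_polynomial_inv:
  "exponential_polynomial f \<Longrightarrow> exponential_polynomial (\<lambda>x. inv\<^bsub>G\<^esub> f x)"
  unfolding exponential_polynomial_def using annihilated_inv by (auto simp: Pi_iff)

lemma exponential_polynomial_twist:
  assumes "exponential_polynomial f" "\<psi> \<in> characters"
  shows "exponential_polynomial (\<lambda>x. act (\<psi> x) (f x))"
proof -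
  obtain L where "set L \<subseteq> characters" "annihilated L f"
    using assms unfolding exponential_polynomial_def by blast
  then show ?thesis
    using annihilated_twist[of L f \<psi>] assms unfolding exponential_polynomial_def
    by (auto simp: Pi_iff mult_character subset_iff
        intro!: exI[of _ "map (\<lambda>\<chi> x. \<psi> x \<otimes>\<^bsub>G\<^esub> \<chi> x) L"])
qed

text \<open>
  Expanding the commutator of \<open>p(x h)\<close> and \<open>q(x h)\<close> gives the commutator of \<open>p(x)\<close> and \<open>q(x)\<close>
  times three factors: \<open>[p(h), q(x)]\<close>, \<open>[p(h), q(h)]\<close> and \<open>[p(x), q(h)]\<close>, conjugated by
  \<open>p(x)\<close>, \<open>p(x) q(x)\<close> and \<open>q(x)\<close>. Each factor is a twist of a constant or of a commutator with a
  constant, and $h$ enters only through these constants, so one list of characters serves all $h$.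
\<close>

lemma exponential_polynomial_comm_hom:
  assumes p: "p \<in> hom H G" and q: "q \<in> hom H G"
  shows "exponential_polynomial (\<lambda>x. comm (p x) (q x))"
proof -
  have pc: "p \<in> characters" and qc: "q \<in> characters" using p q hom_character by auto
  let ?tw = "\<lambda>\<psi> L. map (\<lambda>\<chi> x. \<psi> x \<otimes>\<^bsub>G\<^esub> \<chi> x) L"
  let ?one = "\<lambda>_. \<one>\<^bsub>G\<^esub>"
  let ?pq = "\<lambda>x. p x \<otimes>\<^bsub>G\<^esub> q x"
  let ?L1 = "?tw p [?one, \<lambda>x. q x \<otimes>\<^bsub>G\<^esub> \<one>\<^bsub>G\<^esub>]"
  let ?L2 = "?tw ?pq [?one]"
  let ?L3 = "?tw q [?one, \<lambda>x. p x \<otimes>\<^bsub>G\<^esub> \<one>\<^bsub>G\<^esub>]"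
  have chars: "set ?L1 \<subseteq> characters" "set ?L2 \<subseteq> characters" "set ?L3 \<subseteq> characters"
    using pc qc by (auto simp del: r_one intro!: mult_character trivial_character)
  have "annihilated (?one # ?L1 @ ?L2 @ ?L3) (\<lambda>x. comm (p x) (q x))"
    unfolding annihilated.simps
  proof
    fix h assume h: "h \<in> carrier H"
    have "annihilated ?L1 (\<lambda>x. act (p x) (comm (p h) (q x)))"
      using pc qc h by (intro annihilated_twist annihilated_comm_const q)
        (auto simp del: r_one intro!: mult_character trivial_character)
    moreover have "annihilated ?L2 (\<lambda>x. act (?pq x) (comm (p h) (q h)))"
      using pc qc h by (intro annihilated_twist annihilated_const)
        (auto intro!: mult_character trivial_character)
    moreover have "annihilated ?L3 (\<lambda>x. act (q x) (inv\<^bsub>G\<^esub> comm (q h) (p x)))"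
      using pc qc h by (intro annihilated_twist annihilated_inv annihilated_comm_const p)
        (auto simp del: r_one intro!: mult_character trivial_character)
    ultimately have "annihilated (?L1 @ ?L2 @ ?L3) (\<lambda>x. act (p x) (comm (p h) (q x)) \<otimes>\<^bsub>G\<^esub>
        (act (?pq x) (comm (p h) (q h)) \<otimes>\<^bsub>G\<^esub> act (q x) (inv\<^bsub>G\<^esub> comm (q h) (p x))))"
      using pc qc h chars by (intro annihilated_mult_append) (auto simp: Pi_iff)
    then show "annihilated (?L1 @ ?L2 @ ?L3) (\<lambda>x. comm (p (x \<otimes>\<^bsub>H\<^esub> h)) (q (x \<otimes>\<^bsub>H\<^esub> h)) \<otimes>\<^bsub>G\<^esub>
        inv\<^bsub>G\<^esub> act \<one>\<^bsub>G\<^esub> (comm (p x) (q x)))"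
      by (rule annihilated_cong)
        (use p q pc qc h in \<open>simp add: hom_mult comm_mult_left comm_mult_right act_add act_mult
          comm_swap[of "q h" "p x" for x]
          act_commute[of "q x" "p x" for x] D_ac\<close>)
  qed
  moreover have "set (?one # ?L1 @ ?L2 @ ?L3) \<subseteq> characters"
    using chars trivial_character by simp
  ultimately show ?thesis
    unfolding exponential_polynomial_def using pc qc by (blast intro: comm_in_D character_closed)
qed

section \<open>Commutators of words\<close>

inductive_set word_functions :: "('c \<Rightarrow> 'a) set \<Rightarrow> ('c \<Rightarrow> 'a) set" for P where
  one: "(\<lambda>_. \<one>\<^bsub>G\<^esub>) \<in> word_functions P"
| gen: "p \<in> P \<Longrightarrow> p \<in> word_functions P"
| inv: "u \<in> word_functions P \<Longrightarrow> (\<lambda>x. inv\<^bsub>G\<^esub> u x) \<in> word_functions P"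
| mult: "u \<in> word_functions P \<Longrightarrow> v \<in> word_functions P \<Longrightarrow>
    (\<lambda>x. u x \<otimes>\<^bsub>G\<^esub> v x) \<in> word_functions P"

lemma word_function_character: "u \<in> word_functions (hom H G) \<Longrightarrow> u \<in> characters"
  by (induction rule: word_functions.induct)
    (auto intro: hom_character trivial_character inv_character mult_character)

text \<open>
  The commutator identities for products and inverses in the first argument express the commutator
  of a word with $z$ through twists, products and inverses of the commutators of the generators
  with $z$.
\<close>

lemma exponential_polynomial_comm_word_left:
  assumes z: "z \<in> characters"
    and gens: "\<And>p. p \<in> hom H G \<Longrightarrow> exponential_polynomial (\<lambda>x. comm (p x) (z x))"
    and u: "u \<in> word_functions (hom H G)"
  shows "exponential_polynomial (\<lambda>x. comm (u x) (z x))"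
  using u
proof (induction rule: word_functions.induct)
  case one
  show ?case
    by (rule exponential_polynomial_cong[OF exponential_polynomial_one])
      (use z in \<open>simp add: comm_def\<close>)
next
  case (gen p)
  then show ?case by (rule gens)
next
  case (inv u)
  have u: "u \<in> characters" using inv word_function_character by blast
  show ?case
    by (rule exponential_polynomial_cong[OF exponential_polynomial_twist[OF
            exponential_polynomial_inv[OF inv.IH] inv_character[OF u]]])
      (use u z in \<open>simp add: comm_inv_left\<close>)
next
  case (mult u v)
  have u: "u \<in> characters" "v \<in> characters" using mult word_function_character by blast+
  show ?case
    by (rule exponential_polynomial_cong[OF exponential_polynomial_mult[OF
            exponential_polynomial_twist[OF mult.IH(2) u(1)] mult.IH(1)]])
      (use u z in \<open>simp add: comm_mult_left\<close>)
qed

lemma exponential_polynomial_comm_swap: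
  assumes "exponential_polynomial (\<lambda>x. comm (u x) (v x))" "u \<in> characters" "v \<in> characters"
  shows "exponential_polynomial (\<lambda>x. comm (v x) (u x))"
  by (rule exponential_polynomial_cong[OF exponential_polynomial_inv[OF assms(1)]])
    (use assms comm_swap[of "u x" "v x" for x] in simp)

text \<open>
  Reduction to generators in one argument at a time; interchanging the arguments only inverts the
  commutator.
\<close>

lemma exponential_polynomial_comm_word:
  assumes "u \<in> word_functions (hom H G)" "v \<in> word_functions (hom H G)"
  shows "exponential_polynomial (\<lambda>x. comm (u x) (v x))"
proof (rule exponential_polynomial_comm_word_left[OF word_function_character[OF assms(2)] _ assms(1)])
  fix p assume p: "p \<in> hom H G"
  have "exponential_polynomial (\<lambda>x. comm (v x) (p x))"
    by (rule exponential_polynomial_comm_word_left[OF hom_character[OF p] _ assms(2)])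
      (rule exponential_polynomial_comm_hom[OF _ p])
  then show "exponential_polynomial (\<lambda>x. comm (p x) (v x))"
    by (rule exponential_polynomial_comm_swap[OF _ word_function_character[OF assms(2)] hom_character[OF p]])
qed

section \<open>Central exponential polynomials\<close>

lemma centre_subgroup: "subgroup (centre G) G"
proof (rule subgroupI)
  show "centre G \<noteq> {}" by (auto simp: centre_def)
next
  fix a assume a: "a \<in> centre G"
  have "inv\<^bsub>G\<^esub> a \<otimes>\<^bsub>G\<^esub> g = g \<otimes>\<^bsub>G\<^esub> inv\<^bsub>G\<^esub> a" if g: "g \<in> carrier G" for g
  proof -
    have ac: "a \<in> carrier G" and ag: "a \<otimes>\<^bsub>G\<^esub> g = g \<otimes>\<^bsub>G\<^esub> a"
      using a g unfolding centre_def by blast+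
    have "inv\<^bsub>G\<^esub> a \<otimes>\<^bsub>G\<^esub> (g \<otimes>\<^bsub>G\<^esub> a) \<otimes>\<^bsub>G\<^esub> inv\<^bsub>G\<^esub> a = g \<otimes>\<^bsub>G\<^esub> inv\<^bsub>G\<^esub> a"
      using ac g by (simp flip: ag)
    then show ?thesis using ac g by (simp add: m_assoc)
  qed
  moreover have "inv\<^bsub>G\<^esub> a \<in> carrier G" using a by (simp add: centre_def)
  ultimately show "inv\<^bsub>G\<^esub> a \<in> centre G" unfolding centre_def by blast
next
  fix a b assume a: "a \<in> centre G" and b: "b \<in> centre G"
  have "a \<otimes>\<^bsub>G\<^esub> b \<otimes>\<^bsub>G\<^esub> g = g \<otimes>\<^bsub>G\<^esub> (a \<otimes>\<^bsub>G\<^esub> b)" if g: "g \<in> carrier G" for g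
  proof -
    have ab: "a \<in> carrier G" "b \<in> carrier G"
      and ag: "a \<otimes>\<^bsub>G\<^esub> g = g \<otimes>\<^bsub>G\<^esub> a" and bg: "b \<otimes>\<^bsub>G\<^esub> g = g \<otimes>\<^bsub>G\<^esub> b"
      using a b g unfolding centre_def by blast+
    have "a \<otimes>\<^bsub>G\<^esub> b \<otimes>\<^bsub>G\<^esub> g = a \<otimes>\<^bsub>G\<^esub> g \<otimes>\<^bsub>G\<^esub> b"
      using ab g bg by (simp add: m_assoc)
    also have "\<dots> = g \<otimes>\<^bsub>G\<^esub> (a \<otimes>\<^bsub>G\<^esub> b)"
      using ab g by (simp add: ag m_assoc)
    finally show ?thesis .
  qed
  moreover have "a \<otimes>\<^bsub>G\<^esub> b \<in> carrier G" using a b unfolding centre_def by blast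
  ultimately show "a \<otimes>\<^bsub>G\<^esub> b \<in> centre G" unfolding centre_def by blast
qed (auto simp: centre_def)

text \<open>
  On central values the twist does nothing, so a twisted difference is an ordinary difference; it
  has central values again, which carries the induction.
\<close>

lemma annihilated_central_imp_differences_vanish:
  assumes "set L \<subseteq> characters" "annihilated L f"
    "f \<in> carrier H \<rightarrow> D" "f \<in> carrier H \<rightarrow> centre G"
    "length hs = length L" "set hs \<subseteq> carrier H" "x \<in> carrier H"
  shows "fold (diff_op H (G\<lparr>carrier := centre G\<rparr>)) hs f x = \<one>\<^bsub>G\<^esub>"
  using assms
proof (induction L arbitrary: f hs)
  case (Cons \<chi> L)
  obtain h hs' where hs: "hs = h # hs'" using Cons.prems(5) by (cases hs) auto
  have h: "h \<in> carrier H" using Cons.prems hs by simp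
  have fD: "f x \<in> D" and fZ: "f x \<in> centre G" if "x \<in> carrier H" for x
    using Cons.prems that by auto
  define d where "d = diff_op H (G\<lparr>carrier := centre G\<rparr>) h f"
  have d: "d x = inv\<^bsub>G\<^esub> f x \<otimes>\<^bsub>G\<^esub> f (x \<otimes>\<^bsub>H\<^esub> h)" if "x \<in> carrier H" for x
    using that fZ m_inv_consistent[OF centre_subgroup] by (simp add: d_def diff_op_def)
  have fixed: "act (\<chi> h) (f x) = f x" if "x \<in> carrier H" for x
  proof -
    have "\<chi> h \<otimes>\<^bsub>G\<^esub> f x = f x \<otimes>\<^bsub>G\<^esub> \<chi> h"
      using that fZ[of x] Cons.prems h by (simp add: centre_def)
    then show ?thesis
      using that fD[of x] Cons.prems h by (simp add: act_def m_assoc)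
  qed
  have "annihilated L (\<lambda>x. f (x \<otimes>\<^bsub>H\<^esub> h) \<otimes>\<^bsub>G\<^esub> inv\<^bsub>G\<^esub> act (\<chi> h) (f x))"
    using Cons.prems h by simp
  then have "annihilated L d"
    by (rule annihilated_cong) (use d fixed fD h in \<open>simp add: D_commute\<close>)
  moreover have "d \<in> carrier H \<rightarrow> D"
    using h by (auto simp: d intro!: D_closed fD)
  moreover have "d \<in> carrier H \<rightarrow> centre G"
    using h by (auto simp: d intro!: subgroup.m_closed[OF centre_subgroup]
        subgroup.m_inv_closed[OF centre_subgroup] fZ)
  ultimately have "fold (diff_op H (G\<lparr>carrier := centre G\<rparr>)) hs' d x = \<one>\<^bsub>G\<^esub>"
    using Cons.prems hs by (intro Cons.IH) simp_all
  then show ?case by (simp add: hs d_def)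
qed simp

theorem central_exponential_polynomial_is_polynomial:
  assumes "exponential_polynomial f" "f \<in> carrier H \<rightarrow> centre G"
  shows "polynomial_map H (G\<lparr>carrier := centre G\<rparr>) f"
proof -
  obtain L where L: "set L \<subseteq> characters" "annihilated L f" and f: "f \<in> carrier H \<rightarrow> D"
    using assms unfolding exponential_polynomial_def by blast
  \<comment> \<open>Degree at most $n$ means that $n + 1$ differences vanish; the extra trivial character makes $n$ the length of $L$.\<close>
  let ?L = "(\<lambda>_. \<one>\<^bsub>G\<^esub>) # L"
  have "annihilated ?L f" using annihilated_Cons[OF L(1) f L(2) trivial_character] .
  then have "polynomial_of_degree_le H (G\<lparr>carrier := centre G\<rparr>) (length L) f"
    using annihilated_central_imp_differences_vanish[of ?L f] L f assms(2) trivial_character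
    unfolding polynomial_of_degree_le_def by simp
  then show ?thesis unfolding polynomial_map_def by blast
qed

end

section \<open>Word maps of commutator words\<close>

lemma (in group) group_power_group: "group (power_group G k)"
  unfolding power_group_def by (simp add: product_group is_group)

lemma (in group) projection_hom: "i < k \<Longrightarrow> (\<lambda>g. g i) \<in> hom (power_group G k) G"
  by (auto simp: hom_def power_group_def PiE_iff)

lemma (in group) metabelian_valued_maps_power_group:
  "metabelian G \<Longrightarrow> metabelian_valued_maps G (power_group G k)"
  by (intro metabelian_valued_maps.intro metabelian_valued_maps_axioms.intro
      is_group group_power_group)

text \<open>
  Substitution of a tuple is a homomorphism on the free group, so the word map of a commutator of
  two words is the pointwise commutator of their word maps, and exponential polynomials are closed
  under the products and inverses that generate the derived subgroup.
\<close>

lemma (in group) commutator_word_exponential_polynomial: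
  assumes "metabelian G" and w: "w \<in> commutator_words k"
  shows "metabelian_valued_maps.exponential_polynomial G (power_group G k) (word_map G w)"
proof -
  interpret P: metabelian_valued_maps G "power_group G k"
    using assms(1) by (rule metabelian_valued_maps_power_group)
  interpret F: group "free_group k" by (rule group_free_group)
  have tuple: "g \<in> {..<k} \<rightarrow> carrier G" if "g \<in> carrier (power_group G k)" for g
    using that by (auto simp: power_group_def)
  have hom: "group_hom (free_group k) G (\<lambda>w. word_map G w g)"
    if "g \<in> carrier (power_group G k)" for g
    using word_map_hom[OF tuple[OF that]] is_group group_free_group
    by (simp add: group_hom_def group_hom_axioms_def)
  have words: "word_map G u \<in> P.word_functions (hom (power_group G k) G)"
    if "fst ` set u \<subseteq> {..<k}" for u
    using that
  proof (induction u)
    case Nil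
    show ?case using P.word_functions.one by (simp add: word_map_def[abs_def])
  next
    case (Cons a u)
    have "(\<lambda>g. letter_value G g a) \<in> P.word_functions (hom (power_group G k) G)"
      using projection_hom[of "fst a" k] Cons.prems
      by (cases "snd a") (auto simp: letter_value_def intro: P.word_functions.intros)
    then show ?case
      using P.word_functions.mult[OF _ Cons.IH] Cons.prems by (simp add: word_map_def[abs_def])
  qed
  have closed: "u \<in> carrier (free_group k)"
    if "u \<in> generate (free_group k) (derived_set (free_group k) (carrier (free_group k)))" for u
    using that F.generate_in_carrier F.derived_set_in_carrier by blast
  have "P.exponential_polynomial (\<lambda>g. word_map G c g)"
    if c: "c \<in> derived_set (free_group k) (carrier (free_group k))" for c
  proof -
    obtain u v where u: "u \<in> carrier (free_group k)" and v: "v \<in> carrier (free_group k)"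
      and c: "c = u \<otimes>\<^bsub>free_group k\<^esub> v \<otimes>\<^bsub>free_group k\<^esub> inv\<^bsub>free_group k\<^esub> u
        \<otimes>\<^bsub>free_group k\<^esub> inv\<^bsub>free_group k\<^esub> v"
      using c by auto
    have "P.exponential_polynomial (\<lambda>g. P.comm (word_map G u g) (word_map G v g))"
      using u v by (intro P.exponential_polynomial_comm_word words) (auto simp: free_group_def)
    then show ?thesis
    proof (rule P.exponential_polynomial_cong)
      fix g assume "g \<in> carrier (power_group G k)"
      then interpret h: group_hom "free_group k" G "\<lambda>w. word_map G w g" by (rule hom)
      show "P.comm (word_map G u g) (word_map G v g) = word_map G c g"
        using u v by (simp add: c P.comm_def)
    qed
  qed note comm = this
  show ?thesis using w unfolding commutator_words_def derived_def
  proof (induction rule: generate.induct)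
    case one
    show ?case
      using P.exponential_polynomial_one by (simp add: word_map_def[abs_def] free_group_def)
  next
    case (incl c)
    then show ?case by (rule comm)
  next
    case (inv c)
    show ?case
    proof (rule P.exponential_polynomial_cong[OF P.exponential_polynomial_inv[OF comm[OF inv]]])
      fix g assume "g \<in> carrier (power_group G k)"
      then interpret h: group_hom "free_group k" G "\<lambda>w. word_map G w g" by (rule hom)
      show "inv word_map G c g = word_map G (inv\<^bsub>free_group k\<^esub> c) g"
        using closed[OF generate.incl[OF inv]] by simp
    qed
  next
    case (eng u v)
    show ?case
    proof (rule P.exponential_polynomial_cong[OF P.exponential_polynomial_mult[OF eng.IH]])
      fix g assume "g \<in> carrier (power_group G k)"
      then interpret h: group_hom "free_group k" G "\<lambda>w. word_map G w g" by (rule hom)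
      show "word_map G u g \<otimes> word_map G v g = word_map G (u \<otimes>\<^bsub>free_group k\<^esub> v) g"
        using eng.hyps closed by simp
    qed
  qed
qed

theorem theorem4p4:
  fixes G :: "('a, 'b) monoid_scheme" and k :: nat and w :: "letter list"
  assumes "group G" and "metabelian G"
    and "w \<in> commutator_words k"
    and "word_values G k w \<subseteq> centre G"
  shows "polynomial_map (power_group G k) (G\<lparr>carrier := centre G\<rparr>) (word_map G w)"
proof -
  interpret group G by fact
  interpret metabelian_valued_maps G "power_group G k"
    using assms(2) by (rule metabelian_valued_maps_power_group)
  show ?thesis
  proof (rule central_exponential_polynomial_is_polynomial)
    show "exponential_polynomial (word_map G w)"
      using commutator_word_exponential_polynomial assms by blast
    show "word_map G w \<in> carrier (power_group G k) \<rightarrow> centre G"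
      using assms(4) by (auto simp: word_values_def)
  qed
qed

end
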